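(* Let $\alpha,\beta\in[0,1]$. If $G$ is a graph on $n$ vertices and $\mathrm{Z}_{\alpha,\beta}(G)=1$, then $G$ is (isomorphic to) the path $P_n$ on $n$ vertices.
   Context: All graphs are finite and simple with nonempty vertex set. Let $\alpha,\beta\in[0,1]$ (the transmission proportion and the transmission threshold), let $G$ be a graph and $B\subseteq V(G)$ a set of initially filled vertices. The transmission forcing process started from $B$ is defined as follows. Put $B_0=B$, $w_0(v)=1$ for $v\in B$ and $w_0(v)=0$ for $v\in V(G)\setminus B$. For $t\ge 1$, given the set $B_{t-1}$ of vertices filled at time $t-1$ and the weights $w_{t-1}$: for each unfilled vertex $u\in V(G)\setminus B_{t-1}$ let $\mathcal V_{t,u}$ be the set of all $v\in B_{t-1}$ such that $u$ is the only neighbor of $v$ in $V(G)\setminus B_{t-1}$ and $v\notin \mathcal V_{s,u'}$ for every $s<t$ and every $u'$ (each vertex transmits weight at most once); when $v\in\mathcal V_{t,u}$ we say $v$ forces $u$, written $v\to u$. Set $w_t(u)=w_{t-1}(u)+\sum_{v\in\mathcal V_{t,u}}\alpha\, w_{t-1}(v)$ for $u\in V(G)\setminus B_{t-1}$ and $w_t(u)=w_{t-1}(u)$ for $u\in B_{t-1}$. Then $B_t=B_{t-1}\cup\{u\in V(G)\setminus B_{t-1} : w_t(u)\ge\beta\}$. The set $B$ is an $(\alpha,\beta)$-transmission zero forcing set of $G$ if $B_t=V(G)$ for some $t\ge 0$, and the $(\alpha,\beta)$-transmission zero forcing number $\mathrm{Z}_{\alpha,\beta}(G)$ is the minimum cardinality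 of such a set. *)

theory Defs
  imports Complex_Main "HOL-Library.Indicator_Function" "Graph_Theory.Graph_Theory"
begin

text \<open>
  Finite simple graphs are rendered by the locale \<^locale>\<open>pair_graph\<close>: finite, symmetric,
  loop-free digraphs whose arcs are pairs of vertices. The empty graph is not excluded by the locale.
\<close>

definition path_graph :: "nat \<Rightarrow> nat pair_pre_digraph" where
  "path_graph n = \<lparr> pverts = {..<n},
     parcs = {(i, j). i < n \<and> j < n \<and> (j = Suc i \<or> i = Suc j)} \<rparr>"

lemma pair_graph_path_graph: "pair_graph (path_graph n)"
proof -
  have "finite (parcs (path_graph n))"
    by (rule finite_subset[of _ "{..<n} \<times> {..<n}"]) (auto simp: path_graph_def)
  then show ?thesis
    by unfold_locales (auto simp: path_graph_def symmetric_def intro: symI)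
qed

text \<open>
  \<open>F\<close> is the set of currently filled vertices and \<open>S\<close> the set of vertices that
  have already transmitted their weight.
\<close>

definition forcers :: "'a pair_pre_digraph \<Rightarrow> 'a set \<Rightarrow> 'a set \<Rightarrow> 'a \<Rightarrow> 'a set" where
  "forcers G F S u =
     {v \<in> F. {x \<in> pverts G - F. v \<rightarrow>\<^bsub>with_proj G\<^esub> x} = {u} \<and> v \<notin> S}"

definition transmit ::
  "'a pair_pre_digraph \<Rightarrow> real \<Rightarrow> 'a set \<Rightarrow> 'a set \<Rightarrow> ('a \<Rightarrow> real) \<Rightarrow> 'a \<Rightarrow> real" where
  "transmit G \<alpha> F S w u =
     (if u \<in> pverts G - F then w u + (\<Sum>v\<in>forcers G F S u. \<alpha> * w v) else w u)"

text \<open>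
  The state at time \<open>t\<close> consists of \<open>B\<^sub>t\<close>, \<open>w\<^sub>t\<close> and the vertices that have transmitted
  at some time \<open>s \<le> t\<close>; the last component replaces the reference to all earlier times in
  the condition that each vertex transmits at most once (see \<open>forcing_set_Suc\<close> below).
\<close>

primrec transmission_state ::
  "'a pair_pre_digraph \<Rightarrow> real \<Rightarrow> real \<Rightarrow> 'a set \<Rightarrow> nat \<Rightarrow> 'a set \<times> ('a \<Rightarrow> real) \<times> 'a set" where
  "transmission_state G \<alpha> \<beta> B 0 = (B, indicator B, {})"
| "transmission_state G \<alpha> \<beta> B (Suc t) =
     (case transmission_state G \<alpha> \<beta> B t of (F, w, S) \<Rightarrow>
        (F \<union> {u \<in> pverts G - F. transmit G \<alpha> F S w u \<ge> \<beta>},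
         transmit G \<alpha> F S w,
         S \<union> (\<Union>u \<in> pverts G - F. forcers G F S u)))"

definition filled :: "'a pair_pre_digraph \<Rightarrow> real \<Rightarrow> real \<Rightarrow> 'a set \<Rightarrow> nat \<Rightarrow> 'a set" where
  "filled G \<alpha> \<beta> B t = fst (transmission_state G \<alpha> \<beta> B t)"

definition transmission_forcing_set ::
  "'a pair_pre_digraph \<Rightarrow> real \<Rightarrow> real \<Rightarrow> 'a set \<Rightarrow> bool" where
  "transmission_forcing_set G \<alpha> \<beta> B \<longleftrightarrow>
     B \<subseteq> pverts G \<and> (\<exists>t. filled G \<alpha> \<beta> B t = pverts G)"

definition transmission_forcing_number ::
  "'a pair_pre_digraph \<Rightarrow> real \<Rightarrow> real \<Rightarrow> nat" where
  "transmission_forcing_number G \<alpha> \<beta> = Min (card ` {B. transmission_forcing_set G \<alpha> \<beta> B})"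

lemma transmission_forcing_number_well_defined:
  assumes "pair_graph G"
  shows "finite {B. transmission_forcing_set G \<alpha> \<beta> B}"
    and "{B. transmission_forcing_set G \<alpha> \<beta> B} \<noteq> {}"
proof -
  interpret pair_graph G by fact
  have "{B. transmission_forcing_set G \<alpha> \<beta> B} \<subseteq> Pow (pverts G)"
    by (auto simp: transmission_forcing_set_def)
  then show "finite {B. transmission_forcing_set G \<alpha> \<beta> B}"
    by (rule finite_subset) (rule finite_Pow_iff[THEN iffD2, OF pair_finite_verts])
  have "filled G \<alpha> \<beta> (pverts G) 0 = pverts G"
    by (simp add: filled_def)
  then have "transmission_forcing_set G \<alpha> \<beta> (pverts G)"
    unfolding transmission_forcing_set_def by (intro conjI subset_refl exI)
  then show "{B. transmission_forcing_set G \<alpha> \<beta> B} \<noteq> {}"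
    by (simp only: ex_in_conv[symmetric] mem_Collect_eq) (rule exI)
qed

text \<open>
  The process in time-indexed form: \<open>weight\<close> is \<open>w\<^sub>t\<close> and \<open>forcing_set \<dots> t u\<close> is the set
  of vertices that force \<open>u\<close> at time \<open>t\<close>, which is empty for \<open>t = 0\<close>.
\<close>

definition weight :: "'a pair_pre_digraph \<Rightarrow> real \<Rightarrow> real \<Rightarrow> 'a set \<Rightarrow> nat \<Rightarrow> 'a \<Rightarrow> real" where
  "weight G \<alpha> \<beta> B t = fst (snd (transmission_state G \<alpha> \<beta> B t))"

definition forcing_set ::
  "'a pair_pre_digraph \<Rightarrow> real \<Rightarrow> real \<Rightarrow> 'a set \<Rightarrow> nat \<Rightarrow> 'a \<Rightarrow> 'a set" where
  "forcing_set G \<alpha> \<beta> B t u = (case t of 0 \<Rightarrow> {} | Suc t' \<Rightarrow>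
     if u \<in> pverts G - filled G \<alpha> \<beta> B t'
     then forcers G (filled G \<alpha> \<beta> B t') (snd (snd (transmission_state G \<alpha> \<beta> B t'))) u
     else {})"

lemma transmitted_eq:
  "snd (snd (transmission_state G \<alpha> \<beta> B t)) = (\<Union>s\<in>{..t}. \<Union>u. forcing_set G \<alpha> \<beta> B s u)"
proof (induction t)
  case 0
  show ?case by (simp add: forcing_set_def)
next
  case (Suc t)
  have "snd (snd (transmission_state G \<alpha> \<beta> B (Suc t))) =
      snd (snd (transmission_state G \<alpha> \<beta> B t)) \<union> (\<Union>u. forcing_set G \<alpha> \<beta> B (Suc t) u)"
    by (cases "transmission_state G \<alpha> \<beta> B t") (auto simp: forcing_set_def filled_def split: if_splits)
  then show ?case
    unfolding Suc.IH by (auto simp: atMost_Suc)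
qed

lemma forcing_set_Suc:
  assumes "u \<in> pverts G - filled G \<alpha> \<beta> B t"
  shows "forcing_set G \<alpha> \<beta> B (Suc t) u =
    {v \<in> filled G \<alpha> \<beta> B t.
       {x \<in> pverts G - filled G \<alpha> \<beta> B t. (v, x) \<in> parcs G} = {u} \<and>
       (\<forall>s<Suc t. \<forall>u'. v \<notin> forcing_set G \<alpha> \<beta> B s u')}"
proof -
  have "forcing_set G \<alpha> \<beta> B (Suc t) u =
      forcers G (filled G \<alpha> \<beta> B t) (\<Union>s\<in>{..t}. \<Union>u'. forcing_set G \<alpha> \<beta> B s u') u"
    using assms by (simp only: forcing_set_def[of _ _ _ _ "Suc t"] nat.case if_True transmitted_eq)
  then show ?thesis
    by (simp add: forcers_def less_Suc_eq_le Ball_def)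
qed

lemma weight_0: "weight G \<alpha> \<beta> B 0 v = (if v \<in> B then 1 else 0)"
  by (simp add: weight_def)

lemma weight_Suc:
  "weight G \<alpha> \<beta> B (Suc t) u =
     (if u \<in> pverts G - filled G \<alpha> \<beta> B t
      then weight G \<alpha> \<beta> B t u + (\<Sum>v\<in>forcing_set G \<alpha> \<beta> B (Suc t) u. \<alpha> * weight G \<alpha> \<beta> B t v)
      else weight G \<alpha> \<beta> B t u)"
  by (cases "transmission_state G \<alpha> \<beta> B t")
     (simp add: weight_def filled_def forcing_set_def transmit_def)

lemma filled_0: "filled G \<alpha> \<beta> B 0 = B"
  by (simp add: filled_def)

lemma filled_Suc:
  "filled G \<alpha> \<beta> B (Suc t) = filled G \<alpha> \<beta> B t \<union>
     {u \<in> pverts G - filled G \<alpha> \<beta> B t. weight G \<alpha> \<beta> B (Suc t) u \<ge> \<beta>}"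
  by (cases "transmission_state G \<alpha> \<beta> B t") (simp add: weight_def filled_def)

end

theory Submission
  imports Defs
begin

text \<open>
  If \<open>\<beta> = 0\<close> the empty set is forcing, so the number would be \<open>0\<close>. For \<open>\<beta> > 0\<close> an unfilled
  vertex has weight below \<open>\<beta>\<close>, hence is only filled when some filled vertex forces it. Starting
  from one vertex, the filled set is at every time an induced path of which only the last vertex
  can have unfilled neighbours, so each step extends the path at that end or leaves it as it is.
\<close>

text \<open>The list order supplies the numbering of the vertices used by \<open>path_graph\<close>.
  The equivalence rules out chords, so that a list exhausting the vertices gives an isomorphism and
  not just a spanning path.\<close>

definition induced_path :: "'a pair_pre_digraph \<Rightarrow> 'a list \<Rightarrow> bool" where
  "induced_path G xs \<longleftrightarrow> distinct xs \<and> set xs \<subseteq> pverts G \<and>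
     (\<forall>i<length xs. \<forall>j<length xs. (xs ! i, xs ! j) \<in> parcs G \<longleftrightarrow> j = Suc i \<or> i = Suc j)"

text \<open>The only neighbour of \<open>u\<close> on the path is its end, so appending
  \<open>u\<close> creates no chord.\<close>

lemma induced_path_snoc:
  assumes "pair_graph G" and path: "induced_path G xs" and "xs \<noteq> []"
    and u: "u \<in> pverts G - set xs" and last: "(last xs, u) \<in> parcs G"
    and butlast: "\<And>v. v \<in> set (butlast xs) \<Longrightarrow> (v, u) \<notin> parcs G"
  shows "induced_path G (xs @ [u])"
proof -
  interpret pair_graph G by fact
  have sym: "(x, y) \<in> parcs G \<longleftrightarrow> (y, x) \<in> parcs G" for x y
    using sym_arcs by (auto simp: symmetric_def dest: symD)
  have loop: "(u, u) \<notin> parcs G"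
    using no_loops by force
  have arc_to_u: "(xs ! i, u) \<in> parcs G \<longleftrightarrow> Suc i = length xs" if "i < length xs" for i
  proof (cases "Suc i = length xs")
    case True
    then have "xs ! i = last xs"
      using \<open>xs \<noteq> []\<close> by (simp add: last_conv_nth flip: True)
    with True last show ?thesis by simp
  next
    case False
    then have "i < length (butlast xs)" using that by simp
    then have "xs ! i \<in> set (butlast xs)"
      by (metis nth_butlast nth_mem)
    with False butlast show ?thesis by simp
  qed
  have "((xs @ [u]) ! i, (xs @ [u]) ! j) \<in> parcs G \<longleftrightarrow> j = Suc i \<or> i = Suc j"
    if "i < Suc (length xs)" "j < Suc (length xs)" for i j
    using that path arc_to_u[of i] arc_to_u[of j] loop sym[of u "xs ! j"]
    by (auto simp: induced_path_def nth_append less_Suc_eq)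
  then show ?thesis
    using path u by (auto simp: induced_path_def)
qed

lemma digraph_iso_path_graph:
  assumes "pair_graph G" and path: "induced_path G xs" and verts: "set xs = pverts G"
  shows "digraph_iso (with_proj G) (with_proj (path_graph (length xs)))"
proof -
  interpret pair_graph G by fact
  \<comment> \<open>The isomorphism sends each vertex to its position in \<open>xs\<close>.\<close>
  define g where "g = the_inv_into {..<length xs} ((!) xs)"
  have inj: "inj_on ((!) xs) {..<length xs}"
    using path by (auto simp: induced_path_def inj_on_def nth_eq_iff_index_eq)
  have img: "(!) xs ` {..<length xs} = pverts G"
    using verts by (auto simp: set_conv_nth)
  have g_nth: "g (xs ! i) = i" if "i < length xs" for i
    unfolding g_def using inj that by (simp add: the_inv_into_f_f)
  have bij: "bij_betw g (pverts G) {..<length xs}"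
    unfolding g_def by (rule bij_betw_the_inv_into) (simp add: bij_betw_def inj img)
  have arc_verts: "x \<in> pverts G \<and> y \<in> pverts G" if "(x, y) \<in> parcs G" for x y
    using that arc_fst_in_verts arc_snd_in_verts by force
  \<comment> \<open>Arcs are pairs of vertices, so \<open>g\<close> acts on them componentwise;
    \<open>digraph_iso\<close> needs the image to be the whole arc set of the path.\<close>
  have arcs: "map_prod g g ` parcs G = parcs (path_graph (length xs))"
  proof (rule set_eqI)
    fix e :: "nat \<times> nat"
    obtain i j where e: "e = (i, j)" by (cases e)
    have "(i, j) \<in> map_prod g g ` parcs G \<longleftrightarrow>
        i < length xs \<and> j < length xs \<and> (xs ! i, xs ! j) \<in> parcs G"
    proof
      assume "(i, j) \<in> map_prod g g ` parcs G"
      then obtain x y where xy: "(x, y) \<in> parcs G" "g x = i" "g y = j" by auto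
      with arc_verts img obtain k l where "k < length xs" "l < length xs" "x = xs ! k" "y = xs ! l"
        by (metis imageE lessThan_iff)
      with xy g_nth show "i < length xs \<and> j < length xs \<and> (xs ! i, xs ! j) \<in> parcs G"
        by auto
    next
      assume "i < length xs \<and> j < length xs \<and> (xs ! i, xs ! j) \<in> parcs G"
      then show "(i, j) \<in> map_prod g g ` parcs G"
        using g_nth by (force intro: rev_image_eqI)
    qed
    then show "e \<in> map_prod g g ` parcs G \<longleftrightarrow> e \<in> parcs (path_graph (length xs))"
      using path by (auto simp: e induced_path_def path_graph_def)
  qed
  have inj_arcs: "inj_on (map_prod g g) (parcs G)"
    using map_prod_inj_on[OF bij_betw_imp_inj_on[OF bij] bij_betw_imp_inj_on[OF bij]]
    by (rule inj_on_subset) (use arc_verts in auto)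
  define hom where
    "hom = \<lparr>iso_verts = g, iso_arcs = map_prod g g, iso_head = snd, iso_tail = fst\<rparr>"
  have "digraph_isomorphism hom"
    using wf_digraph_axioms bij inj_arcs
    by (auto simp: digraph_isomorphism_def hom_def bij_betw_def)
  moreover have "with_proj (path_graph (length xs)) = app_iso hom (with_proj G)"
    using bij arcs
    by (simp add: app_iso_def hom_def with_proj_def bij_betw_def)
      (simp add: path_graph_def)
  ultimately show ?thesis
    unfolding digraph_iso_def by blast
qed

text \<open>At time 0 the weight is 0, which is below \<beta>. Later, a vertex whose weight had
  reached \<beta> would have been filled in that same step.\<close>

lemma weight_less_of_unfilled:
  assumes "\<beta> > 0" and "u \<in> pverts G - filled G \<alpha> \<beta> B t"
  shows "weight G \<alpha> \<beta> B t u < \<beta>"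
  using assms by (cases t) (auto simp: weight_0 filled_0 filled_Suc)

text \<open>Without a forcer the weight of \<open>u\<close> would not change and would stay below
  \<beta>.\<close>

lemma newly_filled_forced:
  assumes "\<beta> > 0" and "u \<in> filled G \<alpha> \<beta> B (Suc t) - filled G \<alpha> \<beta> B t"
  shows "u \<in> pverts G - filled G \<alpha> \<beta> B t" and "forcing_set G \<alpha> \<beta> B (Suc t) u \<noteq> {}"
proof -
  show u: "u \<in> pverts G - filled G \<alpha> \<beta> B t"
    using assms(2) by (auto simp: filled_Suc)
  have "weight G \<alpha> \<beta> B (Suc t) u \<ge> \<beta>"
    using assms(2) by (auto simp: filled_Suc)
  with weight_less_of_unfilled[OF assms(1) u] u
  show "forcing_set G \<alpha> \<beta> B (Suc t) u \<noteq> {}"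
    by (auto simp: weight_Suc)
qed

text \<open>The last conjunct drives the induction: a vertex before the end has no unfilled
  neighbour and so cannot force.\<close>

lemma filled_induced_path:
  assumes "pair_graph G" and "\<beta> > 0" and "b \<in> pverts G"
  shows "\<exists>xs. xs \<noteq> [] \<and> induced_path G xs \<and> set xs = filled G \<alpha> \<beta> {b} t \<and>
    (\<forall>v\<in>set (butlast xs). \<forall>x\<in>pverts G. (v, x) \<in> parcs G \<longrightarrow> x \<in> set xs)"
proof (induction t)
  case 0
  interpret pair_graph G by fact
  have "(b, b) \<notin> parcs G"
    using no_loops by force
  with \<open>b \<in> pverts G\<close> show ?case
    by (intro exI[of _ "[b]"]) (auto simp: induced_path_def filled_0)
next
  case (Suc t)
  then obtain xs where xs: "xs \<noteq> []" "induced_path G xs" "set xs = filled G \<alpha> \<beta> {b} t"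
    and closed: "\<And>v x. v \<in> set (butlast xs) \<Longrightarrow> x \<in> pverts G \<Longrightarrow> (v, x) \<in> parcs G \<Longrightarrow> x \<in> set xs"
    by blast
  have xs_split: "set xs = insert (last xs) (set (butlast xs))"
    using xs(1) by (metis append_butlast_last_id rotate1.simps(2) set_rotate1 list.simps(15))
  let ?new = "filled G \<alpha> \<beta> {b} (Suc t) - filled G \<alpha> \<beta> {b} t"
  \<comment> \<open>Whoever forces \<open>u\<close> has an unfilled neighbour, hence is
    \<open>last xs\<close>. As \<open>u\<close> is then its only unfilled neighbour, at most one
    vertex is filled per step.\<close>
  have new: "u \<in> pverts G - set xs \<and> {x \<in> pverts G - set xs. (last xs, x) \<in> parcs G} = {u}"
    if u_new: "u \<in> ?new" for u
  proof -
    have u: "u \<in> pverts G - filled G \<alpha> \<beta> {b} t"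
      using newly_filled_forced(1)[OF \<open>\<beta> > 0\<close> u_new] .
    obtain v where "v \<in> forcing_set G \<alpha> \<beta> {b} (Suc t) u"
      using newly_filled_forced(2)[OF \<open>\<beta> > 0\<close> u_new] by blast
    then have v: "v \<in> set xs" "{x \<in> pverts G - set xs. (v, x) \<in> parcs G} = {u}"
      unfolding forcing_set_Suc[OF u] xs(3) by auto
    then have "v \<notin> set (butlast xs)"
      using closed by blast
    with v xs_split have "v = last xs" by blast
    with v u xs(3) show ?thesis by simp
  qed
  have mono: "filled G \<alpha> \<beta> {b} t \<subseteq> filled G \<alpha> \<beta> {b} (Suc t)"
    by (auto simp: filled_Suc)
  show ?case
  proof (cases "?new = {}")
    \<comment> \<open>The process may stall, for instance when the transmitted weight is too small;
      the old path then still works.\<close>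
    case True
    with mono have "filled G \<alpha> \<beta> {b} (Suc t) = set xs"
      using xs(3) by blast
    with xs closed show ?thesis by blast
  next
    case False
    then obtain u where u: "u \<in> ?new" by blast
    have "v = u" if "v \<in> ?new" for v
      using new[OF that] new[OF u] by simp
    with u have "?new = {u}" by blast
    with mono have filled: "set (xs @ [u]) = filled G \<alpha> \<beta> {b} (Suc t)"
      using xs(3) by auto
    have path: "induced_path G (xs @ [u])"
      using induced_path_snoc[OF \<open>pair_graph G\<close> xs(2,1)] new[OF u] closed by blast
    \<comment> \<open>The old end now lies in the \<open>butlast\<close> part; its only unfilled
      neighbour was \<open>u\<close>, which has joined the path.\<close>
    have "x \<in> set (xs @ [u])" if "v \<in> set xs" "x \<in> pverts G" "(v, x) \<in> parcs G" for v x
      using that closed new[OF u] xs_split by auto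
    with path filled show ?thesis
      by (intro exI[of _ "xs @ [u]"]) auto
  qed
qed

lemma transmission_forcing_set_card_number:
  assumes "pair_graph G"
  obtains B where "transmission_forcing_set G \<alpha> \<beta> B"
    and "card B = transmission_forcing_number G \<alpha> \<beta>"
proof -
  have "transmission_forcing_number G \<alpha> \<beta> \<in> card ` {B. transmission_forcing_set G \<alpha> \<beta> B}"
    unfolding transmission_forcing_number_def
    using transmission_forcing_number_well_defined[OF assms] by (intro Min_in) auto
  then show ?thesis using that by auto
qed

text \<open>Weight 0 already meets threshold 0, so the empty set fills everything in one
  step.\<close>

lemma transmission_forcing_number_threshold_0:
  assumes "pair_graph G"
  shows "transmission_forcing_number G \<alpha> 0 = 0"
proof -
  \<comment> \<open>No vertex is filled at time 0, so the sum over forcers is empty.\<close>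
  have "weight G \<alpha> 0 {} (Suc 0) u = 0" for u
    by (cases "u \<in> pverts G - filled G \<alpha> 0 {} 0")
      (simp_all add: weight_Suc forcing_set_Suc weight_0 filled_0)
  then have "filled G \<alpha> 0 {} (Suc 0) = pverts G"
    by (auto simp: filled_Suc filled_0)
  then have "transmission_forcing_set G \<alpha> 0 {}"
    unfolding transmission_forcing_set_def by blast
  then have "transmission_forcing_number G \<alpha> 0 \<le> card ({} :: 'a set)"
    unfolding transmission_forcing_number_def
    using transmission_forcing_number_well_defined(1)[OF assms] by (intro Min_le) (auto intro!: image_eqI[of _ card "{}"])
  then show ?thesis by simp
qed

theorem proposition3p2p1:
  fixes G :: "'a pair_pre_digraph" and \<alpha> \<beta> :: real and n :: nat
  assumes "\<alpha> \<in> {0..1}" and "\<beta> \<in> {0..1}"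
    and "pair_graph G" and "pverts G \<noteq> {}"
    and "card (pverts G) = n"
    and "transmission_forcing_number G \<alpha> \<beta> = 1"
  shows "digraph_iso (with_proj G) (with_proj (path_graph n))"
proof -
  have "\<beta> \<noteq> 0"
    using transmission_forcing_number_threshold_0[OF \<open>pair_graph G\<close>, of \<alpha>] assms(6) by auto
  with assms(2) have "\<beta> > 0" by simp
  obtain B where B: "transmission_forcing_set G \<alpha> \<beta> B" "card B = 1"
    using transmission_forcing_set_card_number[OF \<open>pair_graph G\<close>] assms(6) by metis
  then obtain b where b: "B = {b}"
    by (metis card_1_singletonE)
  obtain t where t: "b \<in> pverts G" "filled G \<alpha> \<beta> {b} t = pverts G"
    using B(1) by (auto simp: b transmission_forcing_set_def)
  obtain xs where xs: "induced_path G xs" "set xs = pverts G"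
    using filled_induced_path[OF \<open>pair_graph G\<close> \<open>\<beta> > 0\<close> t(1), of \<alpha> t] t(2) by auto
  then have "length xs = n"
    using assms(5) by (metis distinct_card induced_path_def)
  then show ?thesis
    using digraph_iso_path_graph[OF \<open>pair_graph G\<close> xs] by simp
qed

end
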